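(* Let $T=T(w_n,v_n,d_n)$. If both $T_0$ and $T_1$ are irreducible and $$\lim_{k\to\infty}\prod_{m=0}^{k}\frac{|w_{j+m}|}{|v_{i+m}|}=0\quad\text{for any } i,j\in\mathbb{Z},$$ then $T$ is irreducible.
   Context: Let $\{e_n\}_{n\in\mathbb{Z}}$ be the standard orthonormal basis of $l^2(\mathbb{Z})$ (complex scalars). For sequences $\{w_n\}_{n\in\mathbb{Z}},\{v_n\}_{n\in\mathbb{Z}}$ of non-zero complex numbers, let $T_0,T_1$ be the bounded bilateral weighted shifts on $l^2(\mathbb{Z})$ given by $T_0e_n=w_ne_{n+1}$ and $T_1e_n=v_ne_{n+1}$. Let $\{d_n\}_{n\in\mathbb{Z}}$ be a uniformly bounded sequence of complex numbers and $X$ the diagonal operator $Xe_n=d_ne_n$; it is assumed that $XT_1\neq T_0X$. Define $$T(w_n,v_n,d_n)=\begin{pmatrix}T_0&XT_1-T_0X\\0&T_1\end{pmatrix}$$ acting on $l^2(\mathbb{Z})\oplus l^2(\mathbb{Z})$. A bounded operator is irreducible if its only reducing subspaces (closed subspaces $\mathcal{M}$ such that $\mathcal{M}$ and $\mathcal{M}^\perp$ are both invariant) are $\{0\}$ and the whole space. *)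

theory Defs
  imports "HOL-Analysis.Analysis"
begin

text \<open>Complex inner product spaces. The inner product is linear in the first argument; the norm and
  the topology are those of the underlying real inner product space, whose inner product is the
  real part of the complex one, so that \<open>cinner x x = (norm x)\<^sup>2\<close>.\<close>

class complex_inner = real_inner +
  fixes scaleC :: "complex \<Rightarrow> 'a \<Rightarrow> 'a"  (infixr "*\<^sub>C" 75)
    and cinner :: "'a \<Rightarrow> 'a \<Rightarrow> complex"
  assumes scaleC_add_right: "c *\<^sub>C (x + y) = c *\<^sub>C x + c *\<^sub>C y"
    and scaleC_add_left: "(b + c) *\<^sub>C x = b *\<^sub>C x + c *\<^sub>C x"
    and scaleC_scaleC: "b *\<^sub>C c *\<^sub>C x = (b * c) *\<^sub>C x"
    and scaleR_eq_scaleC: "r *\<^sub>R x = complex_of_real r *\<^sub>C x"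
    and cinner_commute: "cinner x y = cnj (cinner y x)"
    and cinner_add_left: "cinner (x + y) z = cinner x z + cinner y z"
    and cinner_scaleC_left: "cinner (c *\<^sub>C x) y = c * cinner x y"
    and inner_eq_Re_cinner: "inner x y = Re (cinner x y)"

text \<open>The Hilbert space direct sum is the product type with the product norm of the library.\<close>

instantiation prod :: (complex_inner, complex_inner) complex_inner
begin

definition "c *\<^sub>C p = (c *\<^sub>C fst p, c *\<^sub>C snd p)"

definition "cinner p q = cinner (fst p) (fst q) + cinner (snd p) (snd q)"

instance
proof
  fix p q :: "'a \<times> 'b"
  show "cinner p q = cnj (cinner q p)"
    using cinner_commute[of "fst p" "fst q"] cinner_commute[of "snd p" "snd q"]
    by (simp add: cinner_prod_def)
qed (auto simp: scaleC_prod_def cinner_prod_def scaleC_add_right scaleC_add_left scaleC_scaleC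
  scaleR_prod_def scaleR_eq_scaleC cinner_add_left cinner_scaleC_left inner_prod_def
  inner_eq_Re_cinner algebra_simps)

end

lemma square_summable_mult_cnj:
  fixes x y :: "'i \<Rightarrow> complex"
  assumes "(\<lambda>n. (cmod (x n))\<^sup>2) summable_on UNIV" "(\<lambda>n. (cmod (y n))\<^sup>2) summable_on UNIV"
  shows "(\<lambda>n. x n * cnj (y n)) summable_on UNIV"
proof (rule Infinite_Sum.abs_summable_summable[OF Infinite_Sum.abs_summable_on_comparison_test'])
  show "(\<lambda>n. (cmod (x n))\<^sup>2 + (cmod (y n))\<^sup>2) summable_on UNIV"
    using assms by (rule summable_on_add)
  fix n
  have "2 * cmod (x n) * cmod (y n) \<le> (cmod (x n))\<^sup>2 + (cmod (y n))\<^sup>2"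
    by (rule sum_squares_bound)
  moreover have "0 \<le> cmod (x n) * cmod (y n)"
    by simp
  ultimately show "norm (x n * cnj (y n)) \<le> (cmod (x n))\<^sup>2 + (cmod (y n))\<^sup>2"
    unfolding norm_mult complex_mod_cnj by linarith
qed

lemma square_summable_add:
  fixes x y :: "'i \<Rightarrow> complex"
  assumes "(\<lambda>n. (cmod (x n))\<^sup>2) summable_on UNIV" "(\<lambda>n. (cmod (y n))\<^sup>2) summable_on UNIV"
  shows "(\<lambda>n. (cmod (x n + y n))\<^sup>2) summable_on UNIV"
proof (rule summable_on_comparison_test)
  show "(\<lambda>n. 2 * (cmod (x n))\<^sup>2 + 2 * (cmod (y n))\<^sup>2) summable_on UNIV"
    using assms by (intro summable_on_add summable_on_cmult_right)
  fix n
  have "(cmod (x n + y n))\<^sup>2 \<le> (cmod (x n) + cmod (y n))\<^sup>2"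
    by (intro power_mono norm_triangle_ineq) auto
  also have "\<dots> \<le> 2 * (cmod (x n))\<^sup>2 + 2 * (cmod (y n))\<^sup>2"
    using sum_squares_bound[of "cmod (x n)" "cmod (y n)"] by (simp add: power2_sum)
  finally show "(cmod (x n + y n))\<^sup>2 \<le> 2 * (cmod (x n))\<^sup>2 + 2 * (cmod (y n))\<^sup>2" .
qed auto

lemma square_summable_scale:
  fixes x :: "'i \<Rightarrow> complex"
  assumes "(\<lambda>n. (cmod (x n))\<^sup>2) summable_on UNIV"
  shows "(\<lambda>n. (cmod (c * x n))\<^sup>2) summable_on UNIV"
  using assms by (simp add: norm_mult power_mult_distrib summable_on_cmult_right)

typedef 'i ell2 = "{x :: 'i \<Rightarrow> complex. (\<lambda>n. (cmod (x n))\<^sup>2) summable_on UNIV}"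
  morphisms ell2_nth Abs_ell2
  by (rule exI[of _ "\<lambda>_. 0"]) simp

setup_lifting type_definition_ell2

instantiation ell2 :: (type) complex_inner
begin

lift_definition zero_ell2 :: "'a ell2" is "\<lambda>_. 0" by simp
lift_definition plus_ell2 :: "'a ell2 \<Rightarrow> 'a ell2 \<Rightarrow> 'a ell2" is "\<lambda>x y n. x n + y n"
  by (rule square_summable_add)
lift_definition uminus_ell2 :: "'a ell2 \<Rightarrow> 'a ell2" is "\<lambda>x n. - x n" by simp
lift_definition minus_ell2 :: "'a ell2 \<Rightarrow> 'a ell2 \<Rightarrow> 'a ell2" is "\<lambda>x y n. x n - y n"
  by (subst diff_conv_add_uminus, rule square_summable_add) simp_all
lift_definition scaleC_ell2 :: "complex \<Rightarrow> 'a ell2 \<Rightarrow> 'a ell2" is "\<lambda>c x n. c * x n"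
  by (rule square_summable_scale)
lift_definition cinner_ell2 :: "'a ell2 \<Rightarrow> 'a ell2 \<Rightarrow> complex" is
  "\<lambda>x y. \<Sum>\<^sub>\<infinity>n. x n * cnj (y n)" .

definition scaleR_ell2 :: "real \<Rightarrow> 'a ell2 \<Rightarrow> 'a ell2" where
  "scaleR_ell2 r x = complex_of_real r *\<^sub>C x"
definition inner_ell2 :: "'a ell2 \<Rightarrow> 'a ell2 \<Rightarrow> real" where
  "inner_ell2 x y = Re (cinner x y)"
definition norm_ell2 :: "'a ell2 \<Rightarrow> real" where
  "norm_ell2 x = sqrt (inner x x)"
definition sgn_ell2 :: "'a ell2 \<Rightarrow> 'a ell2" where
  "sgn_ell2 x = inverse (norm x) *\<^sub>R x"
definition dist_ell2 :: "'a ell2 \<Rightarrow> 'a ell2 \<Rightarrow> real" where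
  "dist_ell2 x y = norm (x - y)"
definition uniformity_ell2 :: "('a ell2 \<times> 'a ell2) filter" where
  "uniformity_ell2 = (INF e\<in>{0 <..}. principal {(x, y). dist x y < e})"
definition open_ell2 :: "'a ell2 set \<Rightarrow> bool" where
  "open_ell2 U \<longleftrightarrow> (\<forall>x\<in>U. eventually (\<lambda>(x', y). x' = x \<longrightarrow> y \<in> U) uniformity)"

instance
proof
  fix x y z :: "'a ell2" and b c :: complex and r s :: real
  show "x + y + z = x + (y + z)" "x + y = y + x" "0 + x = x" "- x + x = 0" "x - y = x + - y"
    by (transfer; simp add: add_ac)+
  show addr: "c *\<^sub>C (x + y) = c *\<^sub>C x + c *\<^sub>C y"
    by transfer (simp add: distrib_left)
  show addl: "(b + c) *\<^sub>C x = b *\<^sub>C x + c *\<^sub>C x" for b c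
    by transfer (simp add: distrib_right)
  show assoc: "b *\<^sub>C c *\<^sub>C x = (b * c) *\<^sub>C x" for b c
    by transfer (simp add: mult.assoc)
  show "r *\<^sub>R x = complex_of_real r *\<^sub>C x"
    by (rule scaleR_ell2_def)
  show "r *\<^sub>R (x + y) = r *\<^sub>R x + r *\<^sub>R y"
    unfolding scaleR_ell2_def by transfer (simp add: distrib_left)
  show "(r + s) *\<^sub>R x = r *\<^sub>R x + s *\<^sub>R x"
    by (simp add: scaleR_ell2_def addl)
  show "r *\<^sub>R s *\<^sub>R x = (r * s) *\<^sub>R x"
    by (simp add: scaleR_ell2_def assoc)
  show "1 *\<^sub>R x = x"
    unfolding scaleR_ell2_def by transfer simp
  show comm: "cinner x y = cnj (cinner y x)"
    by transfer (simp flip: infsum_cnj add: mult.commute)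
  show add: "cinner (x + y) z = cinner x z + cinner y z"
    by transfer (simp add: distrib_right infsum_add square_summable_mult_cnj)
  show scale: "cinner (c *\<^sub>C x) y = c * cinner x y" for c
    by transfer (simp add: mult.assoc infsum_cmult_right')
  show "inner x y = Re (cinner x y)"
    by (rule inner_ell2_def)
  show "inner x y = inner y x"
    unfolding inner_ell2_def by (subst comm) simp
  show "inner (x + y) z = inner x z + inner y z"
    by (simp add: inner_ell2_def add)
  show "inner (r *\<^sub>R x) y = r * inner x y"
    by (simp add: inner_ell2_def scaleR_ell2_def scale)
  have self: "inner x x = (\<Sum>\<^sub>\<infinity>n. (cmod (ell2_nth x n))\<^sup>2)"
    unfolding inner_ell2_def
    by transfer (simp add: infsum_Re[symmetric] square_summable_mult_cnj cmod_power2
        flip: power2_eq_square)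
  show "0 \<le> inner x x"
    unfolding self by (rule infsum_nonneg) simp
  show "inner x x = 0 \<longleftrightarrow> x = 0"
  proof
    assume "inner x x = 0"
    then have "(\<Sum>\<^sub>\<infinity>n. (cmod (ell2_nth x n))\<^sup>2) \<le> 0"
      by (simp add: self)
    moreover have "(\<lambda>n. (cmod (ell2_nth x n))\<^sup>2) summable_on UNIV"
      using ell2_nth[of x] by simp
    ultimately have "(cmod (ell2_nth x n))\<^sup>2 = 0" for n
      by (rule nonneg_infsum_le_0D) auto
    then show "x = 0"
      by transfer (simp add: fun_eq_iff)
  next
    assume "x = 0"
    then show "inner x x = 0"
      unfolding self by transfer simp
  qed
qed (rule norm_ell2_def sgn_ell2_def dist_ell2_def uniformity_ell2_def open_ell2_def)+

end

lift_definition ell2_basis :: "'i \<Rightarrow> 'i ell2" is "\<lambda>i n. if n = i then 1 else 0"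
proof -
  fix i :: 'i
  show "(\<lambda>n. (cmod (if n = i then 1 else 0))\<^sup>2) summable_on UNIV"
    by (rule summable_on_cong_neutral[where S = "{i}", THEN iffD1]) auto
qed

definition bounded_clinear :: "('a::complex_inner \<Rightarrow> 'b::complex_inner) \<Rightarrow> bool" where
  "bounded_clinear A \<longleftrightarrow> bounded_linear A \<and> (\<forall>c x. A (c *\<^sub>C x) = c *\<^sub>C A x)"

definition closed_csubspace :: "'a::complex_inner set \<Rightarrow> bool" where
  "closed_csubspace M \<longleftrightarrow>
    closed M \<and> 0 \<in> M \<and> (\<forall>x\<in>M. \<forall>y\<in>M. x + y \<in> M) \<and> (\<forall>c. \<forall>x\<in>M. c *\<^sub>C x \<in> M)"

definition orthogonal_complement :: "'a::complex_inner set \<Rightarrow> 'a set" where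
  "orthogonal_complement M = {x. \<forall>y\<in>M. cinner x y = 0}"

definition reducing_subspace :: "('a::complex_inner \<Rightarrow> 'a) \<Rightarrow> 'a set \<Rightarrow> bool" where
  "reducing_subspace A M \<longleftrightarrow> closed_csubspace M \<and> A ` M \<subseteq> M \<and>
    A ` orthogonal_complement M \<subseteq> orthogonal_complement M"

definition irreducible_operator :: "('a::complex_inner \<Rightarrow> 'a) \<Rightarrow> bool" where
  "irreducible_operator A \<longleftrightarrow>
    bounded_clinear A \<and> (\<forall>M. reducing_subspace A M \<longrightarrow> M = {0} \<or> M = UNIV)"

text \<open>A bounded operator is determined by its values on the basis, so each of the following two
  predicates holds for at most one operator.\<close>

definition bilateral_weighted_shift :: "(int \<Rightarrow> complex) \<Rightarrow> (int ell2 \<Rightarrow> int ell2) \<Rightarrow> bool" where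
  "bilateral_weighted_shift w A \<longleftrightarrow>
    bounded_clinear A \<and> (\<forall>n. A (ell2_basis n) = w n *\<^sub>C ell2_basis (n + 1))"

definition diagonal_operator :: "(int \<Rightarrow> complex) \<Rightarrow> (int ell2 \<Rightarrow> int ell2) \<Rightarrow> bool" where
  "diagonal_operator d A \<longleftrightarrow>
    bounded_clinear A \<and> (\<forall>n. A (ell2_basis n) = d n *\<^sub>C ell2_basis n)"

text \<open>The operator with block matrix \<open>(A B; 0 D)\<close> on the direct sum.\<close>

definition upper_triangular_operator ::
  "('a \<Rightarrow> 'a) \<Rightarrow> ('b \<Rightarrow> 'a) \<Rightarrow> ('b \<Rightarrow> 'b) \<Rightarrow> 'a::complex_inner \<times> 'b::complex_inner \<Rightarrow> 'a \<times> 'b" where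
  "upper_triangular_operator A B D = (\<lambda>(x, y). (A x + B y, D y))"

end

theory Submission
  imports Defs
begin

text \<open>Write \<open>C = X T1 - T0 X\<close>, let \<open>M\<close> reduce \<open>T\<close>, and let \<open>P\<close> be the orthogonal projection onto
  \<open>M\<close>. The splitting of a vector along \<open>M\<close> and its complement is unique, so \<open>P\<close> commutes with \<open>T\<close>
  (\<open>orth_proj_commutes\<close>). As \<open>T\<close> is upper triangular, the lower left corner \<open>B\<close> of \<open>P\<close>, that is
  \<open>B x = snd (P (x, 0))\<close>, then satisfies \<open>T1 B = B T0\<close>.

  This equation links the matrix entries of \<open>B\<close> along each diagonal:
  \<open>v i * b i j = w j * b (i + 1) (j + 1)\<close>. Hence \<open>b i j\<close> is a product of quotients \<open>w / v\<close>
  times a later entry on the same diagonal. The quotient products tend to 0 and the entries of \<open>B\<close> are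
  bounded, so \<open>B = 0\<close> (\<open>shift_intertwiner_eq_zero\<close>). Being self-adjoint, \<open>P\<close> is then block diagonal,
  which means \<open>M = M0 \<times> M1\<close> (\<open>projection_preserves_first_summand_imp_product\<close>).

  The factors reduce \<open>T0\<close> and \<open>T1\<close> respectively, so by irreducibility each is zero or everything, and
  \<open>C\<close> maps \<open>M1\<close> into \<open>M0\<close> and the complement of \<open>M1\<close> into that of \<open>M0\<close>
  (\<open>reducing_product_upper_triangular\<close>). If exactly one of the factors were zero, one of these two
  inclusions would force \<open>C = 0\<close>. Thus \<open>M\<close> is zero or everything.

  The orthogonal projection exists because the sequence space is complete. The projection theorem also
  yields that a closed subspace containing all basis vectors is the whole space, which reduces
  statements about bounded operators to the basis.\<close>

section \<open>Geometry of complex inner product spaces\<close>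

lemma cinner_add_right: "cinner x (y + z) = cinner x y + cinner x z"
  by (subst (1 2 3) cinner_commute) (simp add: cinner_add_left)

lemma cinner_scaleC_right: "cinner x (c *\<^sub>C y) = cnj c * cinner x y"
  by (subst (1 2) cinner_commute) (simp add: cinner_scaleC_left)

lemma cinner_zero_left [simp]: "cinner 0 y = 0"
  using cinner_add_left[of 0 0 y] by simp

lemma cinner_zero_right [simp]: "cinner x 0 = 0"
  using cinner_add_right[of x 0 0] by simp

lemma cinner_diff_left: "cinner (x - y) z = cinner x z - cinner y z"
  using cinner_add_left[of "x - y" y z] by simp

lemma cinner_diff_right: "cinner x (y - z) = cinner x y - cinner x z"
  using cinner_add_right[of x "y - z" z] by simp

lemma scaleC_zero_right [simp]: "c *\<^sub>C (0::'a::complex_inner) = 0"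
  using scaleC_add_right[of c "0::'a" 0] by simp

lemma scaleC_diff_right: "c *\<^sub>C (x - y) = c *\<^sub>C x - c *\<^sub>C (y::'a::complex_inner)"
  using scaleC_add_right[of c "x - y" y] by simp

lemma diff_conv_scaleC: "x - y = x + (-1) *\<^sub>C (y::'a::complex_inner)"
  using scaleR_eq_scaleC[of "-1" y] by simp

lemma cinner_self_eq_zero_iff [simp]: "cinner x x = 0 \<longleftrightarrow> x = 0"
proof
  assume "cinner x x = 0"
  then have "inner x x = 0" by (simp add: inner_eq_Re_cinner)
  then show "x = 0" by simp
qed simp

text \<open>The topology is defined through the real inner product, so continuity and orthogonality of the
  complex one are reduced to the real case by this formula.\<close>

lemma cinner_conv_inner:
  "cinner x y = complex_of_real (inner x y) + \<i> * complex_of_real (inner x (\<i> *\<^sub>C y))"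
  by (simp add: complex_eq_iff inner_eq_Re_cinner cinner_scaleC_right)

lemma continuous_on_cinner_left [continuous_intros]:
  "continuous_on S f \<Longrightarrow> continuous_on S (\<lambda>x. cinner (f x) y)"
  unfolding cinner_conv_inner by (intro continuous_intros)

lemma closed_csubspaceD:
  assumes "closed_csubspace M"
  shows "closed M" "0 \<in> M" "x \<in> M \<Longrightarrow> y \<in> M \<Longrightarrow> x + y \<in> M" "x \<in> M \<Longrightarrow> c *\<^sub>C x \<in> M"
    "x \<in> M \<Longrightarrow> y \<in> M \<Longrightarrow> x - y \<in> M" "x \<in> M \<Longrightarrow> r *\<^sub>R x \<in> M"
  using assms unfolding closed_csubspace_def diff_conv_scaleC[of x y] scaleR_eq_scaleC by auto

lemma bounded_clinearD:
  assumes "bounded_clinear A"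
  shows "bounded_linear A" "A (c *\<^sub>C x) = c *\<^sub>C A x" "A (x + y) = A x + A y"
    "A (x - y) = A x - A y" "A 0 = 0"
  using assms linear_simps[of A] unfolding bounded_clinear_def by auto

lemma closed_csubspace_vimage:
  assumes A: "bounded_clinear A" and M: "closed_csubspace M"
  shows "closed_csubspace (A -` M)"
  unfolding closed_csubspace_def
  using closed_csubspaceD[OF M] bounded_clinearD[OF A]
  by (auto intro!: closed_vimage linear_continuous_on)

lemma orthogonal_complement_iff:
  "x \<in> orthogonal_complement M \<longleftrightarrow> (\<forall>y\<in>M. cinner x y = 0)"
  by (simp add: orthogonal_complement_def)

lemma complement_add:
  "x \<in> orthogonal_complement M \<Longrightarrow> y \<in> orthogonal_complement M \<Longrightarrow> x + y \<in> orthogonal_complement M"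
  by (simp add: orthogonal_complement_iff cinner_add_left)

lemma complement_scaleC:
  "x \<in> orthogonal_complement M \<Longrightarrow> c *\<^sub>C x \<in> orthogonal_complement M"
  by (simp add: orthogonal_complement_iff cinner_scaleC_left)

section \<open>Orthogonal projections\<close>

text \<open>The near-minimizers of the distance from \<open>x\<close> form a decreasing sequence of closed nonempty sets.
  Midpoints of members of \<open>M\<close> lie in \<open>M\<close>, so the parallelogram law makes the diameters of these sets
  shrink to 0; completeness gives a common point.\<close>

lemma nearest_point_exists:
  fixes x :: "'a::{complex_inner, complete_space}"
  assumes M: "closed_csubspace M"
  obtains a where "a \<in> M" "\<And>y. y \<in> M \<Longrightarrow> norm (x - a) \<le> norm (x - y)"
proof -
  define \<delta> where "\<delta> = (INF y\<in>M. (norm (x - y))\<^sup>2)"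
  define S where "S n = {y \<in> M. (norm (x - y))\<^sup>2 \<le> \<delta> + 1 / Suc n}" for n
  have bdd: "bdd_below ((\<lambda>y. (norm (x - y))\<^sup>2) ` M)"
    by (rule bdd_belowI[of _ 0]) auto
  have \<delta>_le: "\<delta> \<le> (norm (x - y))\<^sup>2" if "y \<in> M" for y
    unfolding \<delta>_def by (rule cINF_lower[OF bdd that])
  have close: "(dist y z)\<^sup>2 \<le> 4 / Suc n" if yz: "y \<in> S n" "z \<in> S n" for y z n
  proof -
    have "(1/2) *\<^sub>R (y + z) \<in> M"
      using yz closed_csubspaceD[OF M] by (auto simp: S_def)
    from \<delta>_le[OF this] have "\<delta> \<le> (norm (x - (1/2) *\<^sub>R (y + z)))\<^sup>2" .
    moreover have "(dist y z)\<^sup>2 = 2 * (norm (x - y))\<^sup>2 + 2 * (norm (x - z))\<^sup>2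
        - 4 * (norm (x - (1/2) *\<^sub>R (y + z)))\<^sup>2"
      unfolding dist_norm power2_norm_eq_inner
      by (simp add: inner_diff_left inner_diff_right inner_add_left inner_add_right inner_commute
          algebra_simps)
    moreover have "(norm (x - y))\<^sup>2 \<le> \<delta> + 1 / Suc n" "(norm (x - z))\<^sup>2 \<le> \<delta> + 1 / Suc n"
      using yz by (auto simp: S_def)
    moreover have "4 / real (Suc n) = 4 * (1 / real (Suc n))" by simp
    ultimately show ?thesis by linarith
  qed
  obtain a where a: "\<And>n. a \<in> S n"
  proof (rule decreasing_closed_nest[of S])
    show "closed (S n)" for n
      unfolding S_def using closed_csubspaceD(1)[OF M]
      by (intro closed_Collect_conj closed_Collect_le continuous_intros) auto
    show "S n \<noteq> {}" for n
    proof -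
      have "M \<noteq> {}" using closed_csubspaceD(2)[OF M] by auto
      moreover have "(INF y\<in>M. (norm (x - y))\<^sup>2) < \<delta> + 1 / Suc n" by (simp add: \<delta>_def)
      ultimately obtain y where "y \<in> M" "(norm (x - y))\<^sup>2 < \<delta> + 1 / Suc n"
        using cINF_less_iff[OF _ bdd] by blast
      then show ?thesis by (force simp: S_def)
    qed
    show "S n \<subseteq> S m" if "m \<le> n" for m n
    proof -
      have "1 / real (Suc n) \<le> 1 / real (Suc m)" using that by (simp add: frac_le)
      then show ?thesis unfolding S_def by auto
    qed
    show "\<exists>n. \<forall>y\<in>S n. \<forall>z\<in>S n. dist y z < e" if "e > 0" for e :: real
    proof -
      obtain n where n: "1 / real (Suc n) < e\<^sup>2 / 4"
        using nat_approx_posE[of "e\<^sup>2 / 4"] \<open>e > 0\<close> by auto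
      have "dist y z < e" if "y \<in> S n" "z \<in> S n" for y z
      proof (rule power2_less_imp_less)
        have "4 / real (Suc n) = 4 * (1 / real (Suc n))" by simp
        then show "(dist y z)\<^sup>2 < e\<^sup>2" using close[OF that] n by linarith
      qed (use \<open>e > 0\<close> in simp)
      then show ?thesis by blast
    qed
  qed auto
  have "(norm (x - a))\<^sup>2 \<le> \<delta>"
  proof (rule field_le_epsilon)
    fix e :: real assume "e > 0"
    then obtain n where "1 / real (Suc n) < e" using nat_approx_posE by blast
    then show "(norm (x - a))\<^sup>2 \<le> \<delta> + e" using a[of n] by (simp add: S_def)
  qed
  then have "norm (x - a) \<le> norm (x - y)" if "y \<in> M" for y
    using \<delta>_le[OF that] by (meson norm_ge_zero order_trans power2_le_imp_le)
  moreover have "a \<in> M" using a[of 0] by (simp add: S_def)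
  ultimately show ?thesis using that by blast
qed

text \<open>A residual with a nonzero real inner product with some \<open>m \<in> M\<close> could be shortened by moving \<open>a\<close> along
  \<open>m\<close>. Applying this to \<open>m\<close> and to \<open>\<i> m\<close> handles both parts of the complex inner product.\<close>

lemma nearest_point_residual_orthogonal:
  fixes x :: "'a::complex_inner"
  assumes M: "closed_csubspace M" and a: "a \<in> M"
    and min: "\<And>y. y \<in> M \<Longrightarrow> norm (x - a) \<le> norm (x - y)"
  shows "x - a \<in> orthogonal_complement M"
proof -
  define u where "u = x - a"
  have real: "inner u m = 0" if m: "m \<in> M" for m
  proof (cases "m = 0")
    case False
    \<comment> \<open>the coefficient that minimizes the norm of \<open>u - t m\<close>\<close>
    define t where "t = inner u m / inner m m"
    have "a + t *\<^sub>R m \<in> M"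
      by (intro closed_csubspaceD(3)[OF M] closed_csubspaceD(6)[OF M] a m)
    from min[OF this] have "norm u \<le> norm (u - t *\<^sub>R m)" by (simp add: u_def algebra_simps)
    then have "inner u u \<le> inner (u - t *\<^sub>R m) (u - t *\<^sub>R m)" by (simp add: norm_le)
    also have "\<dots> = inner u u - inner u m * inner u m / inner m m"
    proof -
      have "inner (u - t *\<^sub>R m) (u - t *\<^sub>R m) = inner u u - 2 * t * inner u m + t * (t * inner m m)"
        by (simp add: inner_diff_left inner_diff_right inner_commute[of m u] algebra_simps)
      moreover have "t * inner m m = inner u m"
        using False by (simp add: t_def)
      ultimately show ?thesis by (simp add: t_def)
    qed
    finally have "inner u m * inner u m / inner m m \<le> 0" by simp
    moreover have "0 < inner m m" using False by simp
    ultimately have "inner u m * inner u m \<le> 0"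
      by (metis divide_le_0_iff not_le)
    then show ?thesis by (metis mult_le_0_iff order_antisym)
  qed simp
  have "cinner u m = 0" if "m \<in> M" for m
    using real[OF that] real[of "\<i> *\<^sub>C m"] closed_csubspaceD(4)[OF M that]
    by (simp add: cinner_conv_inner)
  then show ?thesis by (simp add: orthogonal_complement_iff u_def)
qed

definition orth_proj :: "'a::complex_inner set \<Rightarrow> 'a \<Rightarrow> 'a" where
  "orth_proj M x = (THE p. p \<in> M \<and> x - p \<in> orthogonal_complement M)"

lemma orth_proj_eqI:
  assumes M: "closed_csubspace M" and p: "p \<in> M" "x - p \<in> orthogonal_complement M"
  shows "orth_proj M x = p"
  unfolding orth_proj_def
proof (rule the_equality)
  fix q assume q: "q \<in> M \<and> x - q \<in> orthogonal_complement M"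
  have "p - q \<in> M" using p q by (intro closed_csubspaceD(5)[OF M]) auto
  then have "cinner (x - q) (p - q) = 0" "cinner (x - p) (p - q) = 0"
    using p q by (auto simp: orthogonal_complement_iff)
  then have "cinner (p - q) (p - q) = 0"
    by (simp add: cinner_diff_left)
  then show "q = p" by simp
qed (use p in auto)

context
  fixes M :: "'a::{complex_inner, complete_space} set"
  assumes M: "closed_csubspace M"
begin

lemma orth_proj_in: "orth_proj M x \<in> M"
  and orth_proj_residual: "x - orth_proj M x \<in> orthogonal_complement M"
proof -
  obtain a where a: "a \<in> M" "\<And>y. y \<in> M \<Longrightarrow> norm (x - a) \<le> norm (x - y)"
    using nearest_point_exists[OF M] by blast
  note res = nearest_point_residual_orthogonal[OF M a]
  with a(1) show "orth_proj M x \<in> M" "x - orth_proj M x \<in> orthogonal_complement M"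
    using orth_proj_eqI[OF M a(1) res] by auto
qed

lemma norm_orth_proj_le: "norm (orth_proj M x) \<le> norm x"
proof -
  let ?p = "orth_proj M x"
  have "cinner (x - ?p) ?p = 0"
    using orth_proj_in[of x] orth_proj_residual[of x] by (simp add: orthogonal_complement_iff)
  then have "inner (x - ?p) ?p = 0" by (simp add: inner_eq_Re_cinner)
  then have "(norm x)\<^sup>2 = (norm ?p)\<^sup>2 + (norm (x - ?p))\<^sup>2"
    unfolding power2_norm_eq_inner by (simp add: inner_diff_left inner_diff_right inner_commute)
  then show ?thesis by (simp add: power2_le_imp_le)
qed

lemma bounded_clinear_orth_proj: "bounded_clinear (orth_proj M)"
proof -
  have add: "orth_proj M (x + y) = orth_proj M x + orth_proj M y" for x y
    using complement_add[OF orth_proj_residual[of x] orth_proj_residual[of y]]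
    by (intro orth_proj_eqI M closed_csubspaceD(3)[OF M] orth_proj_in) (simp add: algebra_simps)
  have scale: "orth_proj M (c *\<^sub>C x) = c *\<^sub>C orth_proj M x" for c x
    using complement_scaleC[OF orth_proj_residual[of x], of c]
    by (intro orth_proj_eqI M closed_csubspaceD(4)[OF M] orth_proj_in)
      (simp add: scaleC_diff_right)
  show ?thesis
    unfolding bounded_clinear_def
    by (auto intro!: bounded_linear_intro[where K = 1] simp: add scale scaleR_eq_scaleC
        norm_orth_proj_le)
qed

text \<open>Since \<open>M\<close> reduces \<open>A\<close>, the operator maps the splitting of \<open>x\<close> along \<open>M\<close> and its complement to a splitting of
  \<open>A x\<close>, and such a splitting is unique.\<close>

lemma orth_proj_commutes:
  assumes A: "bounded_clinear A" and red: "reducing_subspace A M"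
  shows "orth_proj M (A x) = A (orth_proj M x)"
proof (rule orth_proj_eqI[OF M])
  show "A (orth_proj M x) \<in> M"
    using red orth_proj_in unfolding reducing_subspace_def by blast
  have "A (x - orth_proj M x) \<in> orthogonal_complement M"
    using red orth_proj_residual unfolding reducing_subspace_def by blast
  then show "A x - A (orth_proj M x) \<in> orthogonal_complement M"
    by (simp add: bounded_clinearD[OF A])
qed

end

lemma closed_csubspace_eq_UNIV:
  fixes M :: "'a::{complex_inner, complete_space} set"
  assumes "closed_csubspace M" and "orthogonal_complement M = {0}"
  shows "M = UNIV"
  using orth_proj_in[OF assms(1)] orth_proj_residual[OF assms(1)] assms(2)
  by (metis UNIV_eq_I eq_iff_diff_eq_0 singletonD)

section \<open>The sequence space as a Hilbert space\<close>

lemma ell2_nth_summable: "(\<lambda>n. (cmod (ell2_nth x n))\<^sup>2) summable_on UNIV"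
  using ell2_nth[of x] by simp

lemma norm_ell2_square: "(norm x)\<^sup>2 = (\<Sum>\<^sub>\<infinity>n. (cmod (ell2_nth x n))\<^sup>2)"
proof -
  have "inner x x = (\<Sum>\<^sub>\<infinity>n. (cmod (ell2_nth x n))\<^sup>2)"
    unfolding inner_ell2_def
    by transfer (simp add: infsum_Re[symmetric] square_summable_mult_cnj cmod_power2
        flip: power2_eq_square)
  then show ?thesis by (simp only: power2_norm_eq_inner[of x])
qed

lemma sum_cmod_ell2_nth_le: "finite F \<Longrightarrow> (\<Sum>n\<in>F. (cmod (ell2_nth x n))\<^sup>2) \<le> (norm x)\<^sup>2"
  unfolding norm_ell2_square by (rule finite_sum_le_infsum[OF ell2_nth_summable]) auto

lemma cmod_ell2_nth_le: "cmod (ell2_nth x n) \<le> norm x"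
  by (rule power2_le_imp_le) (use sum_cmod_ell2_nth_le[of "{n}" x] in simp_all)

lemma ell2_nth_diff: "ell2_nth (x - y) n = ell2_nth x n - ell2_nth y n"
  by transfer simp

lemma cinner_ell2_basis: "cinner x (ell2_basis n) = ell2_nth x n"
proof transfer
  fix x :: "'a \<Rightarrow> complex" and n
  have "(\<Sum>\<^sub>\<infinity>k. x k * cnj (if k = n then 1 else 0)) = (\<Sum>\<^sub>\<infinity>k\<in>{n}. x k * cnj (if k = n then 1 else 0))"
    by (rule infsum_cong_neutral) auto
  then show "(\<Sum>\<^sub>\<infinity>k. x k * cnj (if k = n then 1 else 0)) = x n" by simp
qed

lemma ell2_coordinates_zero: "(\<And>n. cinner x (ell2_basis n) = 0) \<Longrightarrow> x = 0"
  unfolding cinner_ell2_basis by transfer (simp add: fun_eq_iff)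

text \<open>A Cauchy sequence converges in each coordinate. Its tail estimates are passed to the limit on
  finite sets of coordinates, where the sum and the limit commute; the resulting bounds are uniform in
  the finite set, which gives both square summability of the limit and convergence in norm.\<close>

instance ell2 :: (type) complete_space
proof
  fix X :: "nat \<Rightarrow> 'a ell2"
  assume C: "Cauchy X"
  have "Cauchy (\<lambda>k. ell2_nth (X k) n)" for n
  proof (rule metric_CauchyI)
    fix e :: real assume "e > 0"
    then obtain N where N: "\<And>j k. j \<ge> N \<Longrightarrow> k \<ge> N \<Longrightarrow> dist (X j) (X k) < e"
      using metric_CauchyD[OF C] by blast
    have "dist (ell2_nth (X j) n) (ell2_nth (X k) n) < e" if "j \<ge> N" "k \<ge> N" for j k
    proof -
      have "dist (ell2_nth (X j) n) (ell2_nth (X k) n) \<le> dist (X j) (X k)"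
        unfolding dist_norm ell2_nth_diff[symmetric] by (rule cmod_ell2_nth_le)
      also have "\<dots> < e" using that by (rule N)
      finally show ?thesis .
    qed
    then show "\<exists>N. \<forall>j\<ge>N. \<forall>k\<ge>N. dist (ell2_nth (X j) n) (ell2_nth (X k) n) < e"
      by blast
  qed
  then have "\<forall>n. \<exists>a. (\<lambda>k. ell2_nth (X k) n) \<longlonglongrightarrow> a"
    by (simp add: Cauchy_convergent_iff convergent_def)
  then obtain l where l: "\<And>n. (\<lambda>k. ell2_nth (X k) n) \<longlonglongrightarrow> l n"
    using choice[of "\<lambda>n a. (\<lambda>k. ell2_nth (X k) n) \<longlonglongrightarrow> a"] by blast
  have tail: "\<exists>N. \<forall>j\<ge>N. \<forall>F. finite F \<longrightarrow> (\<Sum>n\<in>F. (cmod (ell2_nth (X j) n - l n))\<^sup>2) \<le> e\<^sup>2"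
    if e: "e > 0" for e
  proof -
    obtain N where N: "\<And>j k. j \<ge> N \<Longrightarrow> k \<ge> N \<Longrightarrow> dist (X j) (X k) < e"
      using metric_CauchyD[OF C e] by blast
    have "(\<Sum>n\<in>F. (cmod (ell2_nth (X j) n - l n))\<^sup>2) \<le> e\<^sup>2" if "j \<ge> N" "finite F" for j F
    proof (rule LIMSEQ_le_const2)
      show "(\<lambda>k. \<Sum>n\<in>F. (cmod (ell2_nth (X j) n - ell2_nth (X k) n))\<^sup>2)
          \<longlonglongrightarrow> (\<Sum>n\<in>F. (cmod (ell2_nth (X j) n - l n))\<^sup>2)"
        by (intro tendsto_intros l)
      have "(\<Sum>n\<in>F. (cmod (ell2_nth (X j) n - ell2_nth (X k) n))\<^sup>2) \<le> e\<^sup>2" if "k \<ge> N" for k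
      proof -
        have "(\<Sum>n\<in>F. (cmod (ell2_nth (X j) n - ell2_nth (X k) n))\<^sup>2) \<le> (dist (X j) (X k))\<^sup>2"
          using sum_cmod_ell2_nth_le[OF \<open>finite F\<close>, of "X j - X k"]
          by (simp add: ell2_nth_diff dist_norm)
        also have "\<dots> \<le> e\<^sup>2"
          using N[OF \<open>j \<ge> N\<close> \<open>k \<ge> N\<close>] by (intro power_mono) auto
        finally show ?thesis .
      qed
      then show "\<exists>N. \<forall>k\<ge>N. (\<Sum>n\<in>F. (cmod (ell2_nth (X j) n - ell2_nth (X k) n))\<^sup>2) \<le> e\<^sup>2"
        by blast
    qed
    then show ?thesis by blast
  qed
  have sq: "(\<lambda>n. (cmod (l n))\<^sup>2) summable_on UNIV"
  proof -
    obtain N where N: "\<And>F. finite F \<Longrightarrow> (\<Sum>n\<in>F. (cmod (ell2_nth (X N) n - l n))\<^sup>2) \<le> 1"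
      using tail[of 1] by auto
    have "(\<lambda>n. (cmod (ell2_nth (X N) n - l n))\<^sup>2) summable_on UNIV"
      by (rule nonneg_bdd_above_summable_on) (auto intro!: bdd_aboveI[of _ 1] N)
    \<comment> \<open>\<open>l\<close> is the sum of \<open>- (X N - l)\<close> and \<open>X N\<close>\<close>
    then have "(\<lambda>n. (cmod (- (ell2_nth (X N) n - l n)))\<^sup>2) summable_on UNIV"
      by (simp only: norm_minus_cancel)
    from square_summable_add[OF this ell2_nth_summable[of "X N"]] show ?thesis by simp
  qed
  define L where "L = Abs_ell2 l"
  have L: "ell2_nth L = l"
    unfolding L_def using sq by (simp add: Abs_ell2_inverse)
  have "X \<longlonglongrightarrow> L"
  proof (rule metric_LIMSEQ_I)
    fix e :: real assume "e > 0"
    then obtain N where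
      N: "\<And>j F. j \<ge> N \<Longrightarrow> finite F \<Longrightarrow> (\<Sum>n\<in>F. (cmod (ell2_nth (X j) n - l n))\<^sup>2) \<le> (e / 2)\<^sup>2"
      using tail[of "e / 2"] by auto
    have "dist (X j) L < e" if "j \<ge> N" for j
    proof -
      have "(norm (X j - L))\<^sup>2 \<le> (e / 2)\<^sup>2"
        unfolding norm_ell2_square
        using N[OF that]
        by (intro infsum_le_finite_sums ell2_nth_summable) (simp add: ell2_nth_diff L)
      then have "norm (X j - L) \<le> e / 2"
        by (rule power2_le_imp_le) (use \<open>e > 0\<close> in simp)
      then show ?thesis using \<open>e > 0\<close> by (simp add: dist_norm)
    qed
    then show "\<exists>N. \<forall>j\<ge>N. dist (X j) L < e" by blast
  qed
  then show "convergent X" by (auto simp: convergent_def)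
qed

lemma closed_csubspace_ell2_basis_eq_UNIV:
  fixes M :: "'i ell2 set"
  assumes M: "closed_csubspace M" and basis: "\<And>n. ell2_basis n \<in> M"
  shows "M = UNIV"
proof (rule closed_csubspace_eq_UNIV[OF M])
  have "x = 0" if "x \<in> orthogonal_complement M" for x
    by (rule ell2_coordinates_zero) (use that basis in \<open>simp add: orthogonal_complement_iff\<close>)
  moreover have "0 \<in> orthogonal_complement M"
    by (simp add: orthogonal_complement_iff)
  ultimately show "orthogonal_complement M = {0}"
    by blast
qed

section \<open>Intertwiners of weighted shifts\<close>

text \<open>Both sides depend linearly and continuously on \<open>x\<close>, so it is enough to compare them on the
  basis.\<close>

lemma bilateral_weighted_shift_nth:
  assumes A: "bilateral_weighted_shift w A"
  shows "ell2_nth (A x) (n + 1) = w n * ell2_nth x n"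
proof -
  let ?M = "{x. cinner (A x) (ell2_basis (n + 1)) = w n * cinner x (ell2_basis n)}"
  have bc: "bounded_clinear A" and A_basis: "\<And>k. A (ell2_basis k) = w k *\<^sub>C ell2_basis (k + 1)"
    using A unfolding bilateral_weighted_shift_def by blast+
  have "?M = UNIV"
  proof (rule closed_csubspace_ell2_basis_eq_UNIV)
    have "closed ?M"
      by (intro closed_Collect_eq continuous_on_cinner_left continuous_on_mult_left
          continuous_on_id linear_continuous_on bounded_clinearD(1)[OF bc])
    then show "closed_csubspace ?M"
      unfolding closed_csubspace_def
      by (simp add: bounded_clinearD(2,3,5)[OF bc] cinner_add_left cinner_scaleC_left
          distrib_left mult.left_commute)
    show "ell2_basis k \<in> ?M" for k
    proof -
      have "ell2_nth (w k *\<^sub>C ell2_basis (k + 1)) (n + 1) = w n * ell2_nth (ell2_basis k) n"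
        unfolding scaleC_ell2.rep_eq ell2_basis.rep_eq by simp
      then show ?thesis by (simp only: mem_Collect_eq A_basis cinner_ell2_basis)
    qed
  qed
  then have "x \<in> ?M" by (rule ssubst) (rule UNIV_I)
  then show ?thesis by (simp only: mem_Collect_eq cinner_ell2_basis)
qed

text \<open>Every matrix entry of \<open>B\<close> is a product of quotients \<open>w / v\<close> times an entry further down the same
  diagonal. These products tend to 0 and the entries are bounded. The direction of the intertwining
  relation is essential: \<open>A0 B = B A1\<close> leads to quotients \<open>v / w\<close>, whose products do not tend to 0.\<close>

lemma shift_intertwiner_eq_zero:
  assumes v_nonzero: "\<And>n. v n \<noteq> 0"
    and A0: "bilateral_weighted_shift w A0" and A1: "bilateral_weighted_shift v A1"
    and B: "bounded_clinear B" and inter: "\<And>x. A1 (B x) = B (A0 x)"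
    and lim: "\<And>i j :: int.
      (\<lambda>k::nat. \<Prod>m=0..k. cmod (w (j + int m)) / cmod (v (i + int m))) \<longlonglongrightarrow> 0"
  shows "B x = 0"
proof -
  define b where "b i j = ell2_nth (B (ell2_basis j)) i" for i j
  have step: "v i * b i j = w j * b (i + 1) (j + 1)" for i j
  proof -
    have "v i * b i j = ell2_nth (A1 (B (ell2_basis j))) (i + 1)"
      by (simp add: b_def bilateral_weighted_shift_nth[OF A1])
    also have "A1 (B (ell2_basis j)) = w j *\<^sub>C B (ell2_basis (j + 1))"
      using A0 by (simp add: inter bilateral_weighted_shift_def bounded_clinearD[OF B])
    also have "ell2_nth \<dots> (i + 1) = w j * b (i + 1) (j + 1)"
      by (simp add: b_def scaleC_ell2.rep_eq)
    finally show ?thesis .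
  qed
  obtain K where K: "\<And>x. norm (B x) \<le> norm x * K"
    using bounded_linear.bounded[OF bounded_clinearD(1)[OF B]] by blast
  have norm_basis: "norm (ell2_basis j :: int ell2) = 1" for j
  proof -
    have "(norm (ell2_basis j :: int ell2))\<^sup>2 = 1"
      unfolding power2_norm_eq_inner inner_eq_Re_cinner cinner_ell2_basis
      by (simp add: ell2_basis.rep_eq)
    moreover have "0 \<le> norm (ell2_basis j :: int ell2)" by simp
    ultimately show ?thesis unfolding power2_eq_1_iff by linarith
  qed
  have b_le: "cmod (b i j) \<le> K" for i j
    using cmod_ell2_nth_le[of "B (ell2_basis j)" i] K[of "ell2_basis j"]
    by (simp add: b_def norm_basis)
  have iter: "cmod (b i j) = (\<Prod>m=0..k. cmod (w (j + int m)) / cmod (v (i + int m)))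
      * cmod (b (i + int (Suc k)) (j + int (Suc k)))" for i j k
  proof -
    have one: "cmod (b i j) = cmod (w j) / cmod (v i) * cmod (b (i + 1) (j + 1))" for i j
      using arg_cong[OF step[of i j], of cmod] v_nonzero[of i]
      by (simp add: norm_mult field_simps)
    show ?thesis
    proof (induction k)
      case 0
      show ?case using one[of i j] by simp
    next
      case (Suc k)
      show ?case
        by (subst Suc, subst one) (simp add: add_ac)
    qed
  qed
  have "b i j = 0" for i j
  proof -
    have "(\<lambda>k. (\<Prod>m=0..k. cmod (w (j + int m)) / cmod (v (i + int m))) * K) \<longlonglongrightarrow> 0 * K"
      by (intro tendsto_intros lim)
    moreover have "cmod (b i j) \<le> (\<Prod>m=0..k. cmod (w (j + int m)) / cmod (v (i + int m))) * K" for k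
      by (subst iter[of i j k]) (intro mult_left_mono b_le prod_nonneg, auto)
    ultimately have "cmod (b i j) \<le> 0 * K" by (intro LIMSEQ_le_const) auto
    then show ?thesis by simp
  qed
  then have "B (ell2_basis j) = 0" for j
    by (intro ell2_coordinates_zero) (simp add: cinner_ell2_basis b_def)
  moreover have "closed_csubspace (B -` {0})"
    by (intro closed_csubspace_vimage B) (auto simp: closed_csubspace_def)
  ultimately have "B -` {0} = UNIV"
    by (intro closed_csubspace_ell2_basis_eq_UNIV) auto
  then show ?thesis by auto
qed

section \<open>Reducing subspaces of triangular operators\<close>

lemma bounded_clinear_upper_triangular:
  assumes A: "bounded_clinear A" and C: "bounded_clinear C" and D: "bounded_clinear D"
  shows "bounded_clinear (upper_triangular_operator A C D)"
proof -
  have "bounded_linear (\<lambda>p. (A (fst p) + C (snd p), D (snd p)))"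
    by (intro bounded_linear_Pair bounded_linear_add
        bounded_linear_compose[OF bounded_clinearD(1)[OF A] bounded_linear_fst]
        bounded_linear_compose[OF bounded_clinearD(1)[OF C] bounded_linear_snd]
        bounded_linear_compose[OF bounded_clinearD(1)[OF D] bounded_linear_snd])
  then show ?thesis
    unfolding bounded_clinear_def upper_triangular_operator_def case_prod_unfold
    by (simp add: scaleC_prod_def scaleC_add_right bounded_clinearD[OF A] bounded_clinearD[OF C]
        bounded_clinearD[OF D])
qed

lemma complement_product_iff:
  assumes "M = M0 \<times> M1" "0 \<in> M0" "0 \<in> M1"
  shows "(x, y) \<in> orthogonal_complement M \<longleftrightarrow>
    x \<in> orthogonal_complement M0 \<and> y \<in> orthogonal_complement M1"
proof
  assume perp: "(x, y) \<in> orthogonal_complement M"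
  have "cinner x a + cinner y b = 0" if "a \<in> M0" "b \<in> M1" for a b
    using perp that by (auto simp: orthogonal_complement_iff cinner_prod_def assms(1))
  from this[OF _ assms(3)] this[OF assms(2)]
  show "x \<in> orthogonal_complement M0 \<and> y \<in> orthogonal_complement M1"
    by (simp add: orthogonal_complement_iff)
qed (auto simp: orthogonal_complement_iff cinner_prod_def assms(1))

lemma bounded_clinear_compose:
  assumes "bounded_clinear A" "bounded_clinear B"
  shows "bounded_clinear (\<lambda>x. A (B x))"
  using bounded_linear_compose[of A B] assms unfolding bounded_clinear_def by simp

lemma bounded_clinear_snd: "bounded_clinear (snd :: 'a::complex_inner \<times> 'b::complex_inner \<Rightarrow> 'b)"
  unfolding bounded_clinear_def by (simp add: bounded_linear_snd scaleC_prod_def)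

lemma bounded_clinear_inl:
  "bounded_clinear (\<lambda>x::'a::complex_inner. (x, 0::'b::complex_inner))"
  unfolding bounded_clinear_def
  by (simp add: scaleC_prod_def bounded_linear_Pair[OF bounded_linear_ident bounded_linear_zero])

lemma bounded_clinear_inr:
  "bounded_clinear (\<lambda>y::'b::complex_inner. (0::'a::complex_inner, y))"
  unfolding bounded_clinear_def
  by (simp add: scaleC_prod_def bounded_linear_Pair[OF bounded_linear_zero bounded_linear_ident])

text \<open>The hypothesis says that the projection onto \<open>M\<close> maps the first summand into itself. The projection
  is self-adjoint, so it maps the second summand, the complement of the first, into itself as well, and
  \<open>M\<close> is the product of its intersections with the summands. In the proof, self-adjointness appears as
  the orthogonality of \<open>(x, 0) - P (x, 0)\<close> to the given element of \<open>M\<close>.\<close>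

lemma projection_preserves_first_summand_imp_product:
  fixes M :: "('a::{complex_inner, complete_space} \<times> 'b::{complex_inner, complete_space}) set"
  assumes M: "closed_csubspace M" and inv: "\<And>x. snd (orth_proj M (x, 0)) = 0"
  shows "M = {x. (x, 0) \<in> M} \<times> {y. (0, y) \<in> M}"
proof -
  let ?P = "orth_proj M"
  have split: "(x, 0) \<in> M" if xy: "(x, y) \<in> M" for x y
  proof -
    obtain a where a: "?P (x, 0) = (a, 0)" using inv[of x] by (metis prod.collapse)
    have aM: "(a, 0) \<in> M" using orth_proj_in[OF M, of "(x, 0)"] a by simp
    have res: "(x - a, 0) \<in> orthogonal_complement M"
      using orth_proj_residual[OF M, of "(x, 0)"] a by simp
    \<comment> \<open>\<open>(x - a, 0)\<close> is orthogonal to both \<open>(x, y)\<close> and \<open>(a, 0)\<close>\<close>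
    have "cinner (x - a) x = 0" "cinner (x - a) a = 0"
      using res xy aM by (auto simp: orthogonal_complement_iff cinner_prod_def)
    then have "cinner (x - a) (x - a) = 0" by (simp add: cinner_diff_right)
    then show ?thesis using aM by simp
  qed
  have iff: "(x, y) \<in> M \<longleftrightarrow> (x, 0) \<in> M \<and> (0, y) \<in> M" for x y
  proof (intro iffI conjI)
    assume xy: "(x, y) \<in> M"
    show "(x, 0) \<in> M" by (rule split[OF xy])
    show "(0, y) \<in> M" using closed_csubspaceD(5)[OF M xy split[OF xy]] by simp
  next
    assume "(x, 0) \<in> M \<and> (0, y) \<in> M"
    then show "(x, y) \<in> M" using closed_csubspaceD(3)[OF M, of "(x, 0)" "(0, y)"] by simp
  qed
  show ?thesis
  proof (rule set_eqI)
    fix p :: "'a \<times> 'b"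
    obtain x y where p: "p = (x, y)" by (cases p)
    show "p \<in> M \<longleftrightarrow> p \<in> {x. (x, 0) \<in> M} \<times> {y. (0, y) \<in> M}"
      unfolding p mem_Sigma_iff mem_Collect_eq by (rule iff)
  qed
qed

text \<open>The complement of a product is the product of the complements, so invariance of \<open>M\<close> and of its
  complement can both be tested on vectors with one zero component. Testing on \<open>(0, y)\<close> yields the two
  inclusions for the corner \<open>C\<close>, which are what excludes the mixed cases.\<close>

lemma reducing_product_upper_triangular:
  assumes M: "reducing_subspace (upper_triangular_operator A C D) M"
    and prod: "M = M0 \<times> M1" and closed: "closed_csubspace M0" "closed_csubspace M1"
    and A: "bounded_clinear A" and C: "bounded_clinear C" and D: "bounded_clinear D"
  shows "reducing_subspace A M0" "reducing_subspace D M1" "C ` M1 \<subseteq> M0"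
    "C ` orthogonal_complement M1 \<subseteq> orthogonal_complement M0"
proof -
  let ?T = "upper_triangular_operator A C D"
  note zero = closed_csubspaceD(2)[OF closed(1)] closed_csubspaceD(2)[OF closed(2)]
  have czero: "0 \<in> orthogonal_complement M0" "0 \<in> orthogonal_complement M1"
    by (simp_all add: orthogonal_complement_iff)
  note perp = complement_product_iff[OF prod zero]
  have T1: "A x + C y \<in> M0 \<and> D y \<in> M1" if "x \<in> M0" "y \<in> M1" for x y
    using M that unfolding reducing_subspace_def prod
    by (force simp: upper_triangular_operator_def)
  have T2: "A x + C y \<in> orthogonal_complement M0 \<and> D y \<in> orthogonal_complement M1"
    if "x \<in> orthogonal_complement M0" "y \<in> orthogonal_complement M1" for x y
  proof -
    have "?T (x, y) \<in> orthogonal_complement M"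
      using M that perp unfolding reducing_subspace_def by blast
    then show ?thesis by (simp add: upper_triangular_operator_def perp)
  qed
  show "reducing_subspace A M0" "reducing_subspace D M1" "C ` M1 \<subseteq> M0"
    "C ` orthogonal_complement M1 \<subseteq> orthogonal_complement M0"
    using T1[OF _ zero(2)] T1[OF zero(1)] T2[OF _ czero(2)] T2[OF czero(1)] closed
    unfolding reducing_subspace_def bounded_clinearD(5)[OF A] bounded_clinearD(5)[OF C]
      add_0_left add_0_right
    by blast+
qed

section \<open>Irreducibility of the triangular operator\<close>

theorem proposition3p11:
  fixes w v d :: "int \<Rightarrow> complex"
    and T0 T1 X :: "int ell2 \<Rightarrow> int ell2"
    and T :: "int ell2 \<times> int ell2 \<Rightarrow> int ell2 \<times> int ell2"
  assumes w_nonzero: "\<And>n. w n \<noteq> 0"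
    and v_nonzero: "\<And>n. v n \<noteq> 0"
    and T0: "bilateral_weighted_shift w T0"
    and T1: "bilateral_weighted_shift v T1"
    and d_bounded: "bounded (range d)"
    and X: "diagonal_operator d X"
    and not_intertwining: "X \<circ> T1 \<noteq> T0 \<circ> X"
    and T: "T = upper_triangular_operator T0 (\<lambda>x. X (T1 x) - T0 (X x)) T1"
    and T0_irreducible: "irreducible_operator T0"
    and T1_irreducible: "irreducible_operator T1"
    and lim: "\<And>i j :: int.
      (\<lambda>k::nat. \<Prod>m=0..k. cmod (w (j + int m)) / cmod (v (i + int m))) \<longlonglongrightarrow> 0"
  shows "irreducible_operator T"
proof -
  define C where "C x = X (T1 x) - T0 (X x)" for x
  have T_C: "T = upper_triangular_operator T0 C T1" by (simp add: T C_def[abs_def])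
  have bT0: "bounded_clinear T0" and bT1: "bounded_clinear T1" and bX: "bounded_clinear X"
    using T0 T1 X by (auto simp: bilateral_weighted_shift_def diagonal_operator_def)
  have "bounded_linear C"
    unfolding C_def[abs_def]
    by (rule bounded_linear_sub[OF
          bounded_linear_compose[OF bounded_clinearD(1)[OF bX] bounded_clinearD(1)[OF bT1]]
          bounded_linear_compose[OF bounded_clinearD(1)[OF bT0] bounded_clinearD(1)[OF bX]]])
  then have bC: "bounded_clinear C"
    unfolding bounded_clinear_def
    by (simp add: C_def bounded_clinearD[OF bX] bounded_clinearD[OF bT0] bounded_clinearD[OF bT1]
        scaleC_diff_right)
  have bT: "bounded_clinear T"
    unfolding T_C by (rule bounded_clinear_upper_triangular[OF bT0 bC bT1])
  obtain z where z: "C z \<noteq> 0"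
    using not_intertwining by (auto simp: C_def fun_eq_iff)
  have "M = {0} \<or> M = UNIV" if red: "reducing_subspace T M" for M
  proof -
    have M: "closed_csubspace M" using red by (simp add: reducing_subspace_def)
    let ?P = "orth_proj M"
    have bB: "bounded_clinear (\<lambda>x. snd (?P (x, 0)))"
      by (rule bounded_clinear_compose[OF bounded_clinear_snd
            bounded_clinear_compose[OF bounded_clinear_orth_proj[OF M] bounded_clinear_inl]])
    have snd_T: "snd (T p) = T1 (snd p)" for p
      by (simp add: T upper_triangular_operator_def case_prod_unfold)
    have T_inl: "T (x, 0) = (T0 x, 0)" for x
      by (simp add: T_C upper_triangular_operator_def bounded_clinearD(5)[OF bC]
          bounded_clinearD(5)[OF bT1])
    have "T1 (snd (?P (x, 0))) = snd (?P (T0 x, 0))" for x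
      by (simp flip: T_inl snd_T add: orth_proj_commutes[OF M bT red])
    then have inv: "snd (?P (x, 0)) = 0" for x
      by (rule shift_intertwiner_eq_zero[OF v_nonzero T0 T1 bB _ lim])
    define M0 where "M0 = {x. (x, 0) \<in> M}"
    define M1 where "M1 = {y. (0, y) \<in> M}"
    have prod: "M = M0 \<times> M1"
      unfolding M0_def M1_def by (rule projection_preserves_first_summand_imp_product[OF M inv])
    have closed: "closed_csubspace M0" "closed_csubspace M1"
      using closed_csubspace_vimage[OF bounded_clinear_inl M]
        closed_csubspace_vimage[OF bounded_clinear_inr M]
      by (auto simp: M0_def M1_def vimage_def)
    note parts = reducing_product_upper_triangular[OF red[unfolded T_C] prod closed bT0 bC bT1]
    have "M0 = {0} \<or> M0 = UNIV" "M1 = {0} \<or> M1 = UNIV"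
      using T0_irreducible T1_irreducible parts unfolding irreducible_operator_def by auto
    moreover have "\<not> (M0 = {0} \<and> M1 = UNIV)"
      using parts(3) z by auto
    moreover have "\<not> (M0 = UNIV \<and> M1 = {0})"
    proof
      assume triv: "M0 = UNIV \<and> M1 = {0}"
      then have "C z \<in> orthogonal_complement UNIV"
        using parts(4) by (auto simp: orthogonal_complement_iff image_subset_iff)
      then have "cinner (C z) (C z) = 0" by (simp only: orthogonal_complement_iff) blast
      with z show False by simp
    qed
    ultimately show ?thesis using prod by (auto simp: zero_prod_def)
  qed
  with bT show ?thesis by (simp add: irreducible_operator_def)
qed

end
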